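(* Let $\gamma,\lambda\in\mathbb{N}_0$ with $(\lambda,\gamma)\neq(0,0)$ and let $\beta$ be a positive integer. Let $H_n(\lambda,\beta,\gamma)$ denote the coefficient of $\frac{x^n}{n!}$ in $\frac{e^{\gamma x}}{(2-e^{\beta x})^{\lambda}}$. Then for every $n\in\mathbb{N}_0$, $$H_{n+1}(\lambda,\beta,\gamma)=\gamma H_n(\lambda,\beta,\gamma)+\lambda\beta\sum_{i=0}^{n}\binom{n}{i}H_i(1,\beta,\beta)H_{n-i}(\lambda,\beta,\gamma).$$ *)

theory Defs
  imports "HOL-Computational_Algebra.Formal_Power_Series"
begin

(* The exponential generating function is a formal power series over the reals. Its denominator
   has constant coefficient 1, so the division is multiplication by a genuine inverse. *)
definition H_egf :: "nat \<Rightarrow> nat \<Rightarrow> nat \<Rightarrow> real fps" where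
  "H_egf lam \<beta> \<gamma> = fps_exp (of_nat \<gamma>) / (2 - fps_exp (of_nat \<beta>)) ^ lam"

(* The coefficient of x^n/n! is n! times the coefficient of x^n. *)
definition H :: "nat \<Rightarrow> nat \<Rightarrow> nat \<Rightarrow> nat \<Rightarrow> real" where
  "H n lam \<beta> \<gamma> = fact n * fps_nth (H_egf lam \<beta> \<gamma>) n"

end

theory Submission
  imports Defs
begin

text \<open>Differentiating the generating function \<open>F = exp (\<gamma> x) / (2 - exp (\<beta> x)) ^ \<lambda>\<close>
  logarithmically gives \<open>F' = \<gamma> F + \<lambda> \<beta> G F\<close>, where \<open>G = exp (\<beta> x) / (2 - exp (\<beta> x))\<close> is the
  generating function with parameters \<open>(1, \<beta>, \<beta>)\<close>. The recurrence compares coefficients.\<close>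

text \<open>As a power of one inverse, the denominator can be differentiated by induction on
  \<open>lam\<close>.\<close>

lemma H_egf_eq_mult_inverse:
  "H_egf lam \<beta> \<gamma> = fps_exp (of_nat \<gamma>) * inverse (2 - fps_exp (of_nat \<beta>)) ^ lam"
  unfolding H_egf_def by (subst fps_divide_unit) (simp_all add: fps_inverse_power fps_nth_power_0)

lemma fps_deriv_H_egf:
  "fps_deriv (H_egf lam \<beta> \<gamma>) =
     fps_const (real \<gamma>) * H_egf lam \<beta> \<gamma>
     + fps_const (real lam * real \<beta>) * (H_egf 1 \<beta> \<beta> * H_egf lam \<beta> \<gamma>)"
proof -
  define I :: "real fps" where "I = inverse (2 - fps_exp (of_nat \<beta>))"
  have "fps_deriv I = fps_const (real \<beta>) * fps_exp (real \<beta>) * I\<^sup>2"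
    unfolding I_def by (subst fps_inverse_deriv) (simp_all add: fps_numeral_fps_const)
  \<comment> \<open>Since \<open>I' = \<beta> G I\<close> with
    \<open>G = fps_exp (real \<beta>) * I\<close>, each further factor \<open>I\<close> contributes
    one more \<open>\<beta> G\<close>.\<close>
  then have "fps_deriv (I ^ lam) =
      fps_const (real lam * real \<beta>) * (fps_exp (real \<beta>) * I * I ^ lam)"
    by (induction lam)
       (simp_all add: algebra_simps power2_eq_square flip: fps_const_mult fps_const_add)
  then show ?thesis
    unfolding H_egf_eq_mult_inverse I_def[symmetric] by (simp add: algebra_simps)
qed

text \<open>Cauchy product becomes binomial convolution, as \<open>n choose i\<close> is
  \<open>fact n / (fact i * fact (n - i))\<close>.\<close>

lemma fact_mult_fps_nth_mult:
  fixes f g :: "'a :: field_char_0 fps"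
  shows "fact n * fps_nth (f * g) n =
    (\<Sum>i=0..n. of_nat (n choose i) * (fact i * fps_nth f i) * (fact (n - i) * fps_nth g (n - i)))"
  by (simp add: fps_mult_nth sum_distrib_left binomial_fact field_simps)

theorem theorem8:
  fixes lam \<beta> \<gamma> n :: nat
  assumes "(lam, \<gamma>) \<noteq> (0, 0)" and "\<beta> > 0"
  shows "H (n + 1) lam \<beta> \<gamma> =
    real \<gamma> * H n lam \<beta> \<gamma> +
    real lam * real \<beta> * (\<Sum>i=0..n. real (n choose i) * H i 1 \<beta> \<beta> * H (n - i) lam \<beta> \<gamma>)"
proof -
  \<comment> \<open>The factor \<open>n + 1\<close> from differentiation turns \<open>fact n\<close>
    into \<open>fact (n + 1)\<close>.\<close>
  have "H (n + 1) lam \<beta> \<gamma> = fact n * fps_nth (fps_deriv (H_egf lam \<beta> \<gamma>)) n"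
    by (simp add: H_def)
  also have "\<dots> = real \<gamma> * H n lam \<beta> \<gamma> +
      real lam * real \<beta> * (fact n * fps_nth (H_egf 1 \<beta> \<beta> * H_egf lam \<beta> \<gamma>) n)"
    by (simp add: fps_deriv_H_egf H_def del: fps_deriv_nth) (simp add: algebra_simps)
  finally show ?thesis
    by (simp only: fact_mult_fps_nth_mult H_def)
qed

end
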